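(* Let $n\ge1$ and $1<p<\infty$. Then there is a weight $w\in A_p\setminus A_1$ on $\mathbb{R}^n$ such that the operator $M_w f:=w\,M\left(\frac{f}{w}\right)$ satisfies $$\left\|M_w\right\|_{L^1(\mathbb{R}^n)\to L^{1,\infty}(\mathbb{R}^n)}=\infty.$$
   Context: A weight is a nonnegative locally integrable function on $\mathbb{R}^n$. $M$ is the Hardy-Littlewood maximal operator, $Mf(x)=\sup_{Q\ni x}\frac{1}{|Q|}\int_Q|f|$, the supremum being over cubes containing $x$. $A_p$ and $A_1$ are the Muckenhoupt classes: $w\in A_p$ if $\sup_Q\left(\frac{1}{|Q|}\int_Q w\right)\left(\frac{1}{|Q|}\int_Q w^{-1/(p-1)}\right)^{p-1}<\infty$, and $w\in A_1$ if there is a finite constant $C$ with $Mw\leq Cw$ a.e. The space $L^{1,\infty}(\mathbb{R}^n)$ has quasinorm $\|g\|_{L^{1,\infty}(\mathbb{R}^n)}=\sup_{t>0}t\,|\{x\in\mathbb{R}^n:|g(x)|>t\}|$, with respect to Lebesgue measure, and $\|M_w\|_{L^1(\mathbb{R}^n)\to L^{1,\infty}(\mathbb{R}^n)}$ is the supremum of $\|M_wf\|_{L^{1,\infty}(\mathbb{R}^n)}/\|f\|_{L^1(\mathbb{R}^n)}$ over nonzero $f\in L^1(\mathbb{R}^n)$. *)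

theory Defs
  imports "HOL-Analysis.Analysis"
begin

text \<open>Cubes are closed, nondegenerate, with sides parallel to the axes. Averages and the maximal
  function are taken in \<^typ>\<open>ennreal\<close>, so that nothing has to be assumed finite.\<close>

definition cubes :: "(real ^ 'n) set set" where
  "cubes = {cbox a (a + vec l) | a l. 0 < l}"

definition average :: "(real ^ 'n) set \<Rightarrow> (real ^ 'n \<Rightarrow> ennreal) \<Rightarrow> ennreal" where
  "average Q g = (\<integral>\<^sup>+ y \<in> Q. g y \<partial>lebesgue) / emeasure lebesgue Q"

definition maximal :: "(real ^ 'n \<Rightarrow> real) \<Rightarrow> real ^ 'n \<Rightarrow> ennreal" where
  "maximal f x = (SUP Q \<in> {Q \<in> cubes. x \<in> Q}. average Q (\<lambda>y. ennreal \<bar>f y\<bar>))"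

definition locally_integrable :: "(real ^ 'n \<Rightarrow> real) \<Rightarrow> bool" where
  "locally_integrable w \<longleftrightarrow> (\<forall>K. compact K \<longrightarrow> set_integrable lebesgue K w)"

definition weight :: "(real ^ 'n \<Rightarrow> real) \<Rightarrow> bool" where
  "weight w \<longleftrightarrow> (\<forall>x. 0 \<le> w x) \<and> locally_integrable w"

text \<open>Real powers on \<open>[0, \<infinity>]\<close>. The real \<open>powr\<close> satisfies \<open>0 powr a = 0\<close> for negative \<open>a\<close>, which
  would be wrong for the power of a weight in the \<open>A\<^sub>p\<close> condition: here the value is \<open>\<infinity>\<close>.\<close>

definition epowr :: "ennreal \<Rightarrow> real \<Rightarrow> ennreal" where
  "epowr x a =
    (if a = 0 then 1
     else if x = 0 then (if a < 0 then \<infinity> else 0)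
     else if x = \<infinity> then (if a < 0 then 0 else \<infinity>)
     else ennreal (enn2real x powr a))"

definition A_p :: "real \<Rightarrow> (real ^ 'n \<Rightarrow> real) set" where
  "A_p p = {w. weight w \<and>
    (SUP Q \<in> cubes. average Q (\<lambda>y. ennreal (w y)) *
      epowr (average Q (\<lambda>y. epowr (ennreal (w y)) (- 1 / (p - 1)))) (p - 1)) < \<infinity>}"

definition A_1 :: "(real ^ 'n \<Rightarrow> real) set" where
  "A_1 = {w. weight w \<and>
    (\<exists>C::real. 0 \<le> C \<and> (AE x in lebesgue. maximal w x \<le> ennreal C * ennreal (w x)))}"

text \<open>The quotient \<open>f / w\<close> is the real one, equal to \<open>0\<close> where \<open>w\<close> vanishes. For \<open>w\<close> in \<open>A\<^sub>p\<close> and not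
  almost everywhere zero this concerns a null set only, and does not affect \<open>M (f / w)\<close>.\<close>

definition weighted_maximal ::
    "(real ^ 'n \<Rightarrow> real) \<Rightarrow> (real ^ 'n \<Rightarrow> real) \<Rightarrow> real ^ 'n \<Rightarrow> ennreal" where
  "weighted_maximal w f x = ennreal (w x) * maximal (\<lambda>y. f y / w y) x"

definition weak_L1_norm :: "(real ^ 'n \<Rightarrow> ennreal) \<Rightarrow> ennreal" where
  "weak_L1_norm g = (SUP t \<in> {0<..}. ennreal t * emeasure lebesgue {x. ennreal t < g x})"

definition L1_norm :: "(real ^ 'n \<Rightarrow> real) \<Rightarrow> ennreal" where
  "L1_norm f = (\<integral>\<^sup>+ x. ennreal \<bar>f x\<bar> \<partial>lebesgue)"

definition L1_weak_L1_opnorm ::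
    "((real ^ 'n \<Rightarrow> real) \<Rightarrow> real ^ 'n \<Rightarrow> ennreal) \<Rightarrow> ennreal" where
  "L1_weak_L1_opnorm T =
    (SUP f \<in> {f. integrable lebesgue f \<and> \<not> (AE x in lebesgue. f x = 0)}.
      weak_L1_norm (T f) / L1_norm f)"

end

theory Submission
  imports Defs
begin

text \<open>The weight is \<open>w x = (1 + ln (1 + |x|)) powr (p - 1)\<close>. On a cube whose diameter is small
  compared with its distance to the origin, \<open>w\<close> is essentially constant; on a cube of side
  comparable to its largest distance \<open>R\<close> to the origin, \<open>1 + ln (1 + |x|)\<close> is comparable to
  \<open>1 + ln R\<close> except where \<open>|x| \<le> sqrt R\<close>, a set of negligible proportion. Hence \<open>w\<close> is in \<open>A_p\<close>. As
  \<open>w\<close> tends to infinity, \<open>M w\<close> is infinite everywhere, so \<open>w\<close> is not in \<open>A_1\<close>. For the indicator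
  \<open>f\<close> of the unit cube, \<open>M (f / w)\<close> is at least a constant times \<open>R ^ (- n)\<close> on the cube
  \<open>[R, 2 R] ^ n\<close>, where \<open>w\<close> is at least \<open>(1 + ln R) powr (p - 1)\<close>; so already this single \<open>f\<close> has
  infinite weak norm.\<close>

section \<open>Cubes, their volumes and averages over them\<close>

lemma emeasure_cube:
  fixes a :: "real ^ 'n"
  assumes "0 \<le> l"
  shows "emeasure lebesgue (cbox a (a + vec l)) = ennreal (l ^ CARD('n))"
proof -
  have "cbox a (a + vec l) \<noteq> {}"
    using assms by (auto simp: interval_ne_empty_cart)
  then have "measure lborel (cbox a (a + vec l)) = l ^ CARD('n)"
    using content_cbox_cart[of a "a + vec l"] by simp
  moreover have "emeasure lborel (cbox a (a + vec l)) = ennreal (measure lborel (cbox a (a + vec l)))"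
    by (rule emeasure_eq_ennreal_measure) (use emeasure_lborel_cbox_finite[of a "a + vec l"] in auto)
  ultimately show ?thesis
    by simp
qed

lemma cubesE:
  fixes Q :: "(real ^ 'n) set"
  assumes "Q \<in> cubes"
  obtains a l where "Q = cbox a (a + vec l)" "0 < l" "emeasure lebesgue Q = ennreal (l ^ CARD('n))"
proof -
  from assms obtain a l where al: "Q = cbox a (a + vec l)" "0 < l"
    by (auto simp: cubes_def)
  with emeasure_cube[of l a] that show ?thesis
    by simp
qed

lemma cube_between:
  assumes "r < s"
  shows "cbox (vec r :: real ^ 'n) (vec s) \<in> cubes"
proof -
  have "vec r + vec (s - r) = (vec s :: real ^ 'n)"
    by (simp add: vec_eq_iff)
  then show ?thesis
    using assms unfolding cubes_def by (metis (mono_tags, lifting) CollectI diff_gt_0_iff_gt)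
qed

lemma emeasure_cube_between:
  assumes "r \<le> s"
  shows "emeasure lebesgue (cbox (vec r :: real ^ 'n) (vec s)) = ennreal ((s - r) ^ CARD('n))"
proof -
  have "vec r + vec (s - r) = (vec s :: real ^ 'n)"
    by (simp add: vec_eq_iff)
  then show ?thesis
    using assms emeasure_cube[of "s - r" "vec r :: real ^ 'n"] by simp
qed

lemma average_le:
  fixes Q :: "(real ^ 'n) set"
  assumes "Q \<in> cubes" "\<And>y. y \<in> Q \<Longrightarrow> g y \<le> c"
  shows "average Q g \<le> c"
proof -
  from assms(1) obtain a l where Q: "Q = cbox a (a + vec l)" "0 < l"
      "emeasure lebesgue Q = ennreal (l ^ CARD('n))"
    by (rule cubesE)
  have "(\<integral>\<^sup>+ y \<in> Q. g y \<partial>lebesgue) \<le> (\<integral>\<^sup>+ y. c * indicator Q y \<partial>lebesgue)"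
    by (rule nn_integral_mono) (use assms(2) in \<open>auto simp: indicator_def\<close>)
  also have "\<dots> = c * emeasure lebesgue Q"
    by (rule nn_integral_cmult_indicator) (simp add: Q)
  finally have "average Q g \<le> c * emeasure lebesgue Q / emeasure lebesgue Q"
    unfolding average_def by (rule divide_right_mono_ennreal)
  also have "\<dots> = c"
    using Q by (simp add: mult_divide_eq_ennreal)
  finally show ?thesis .
qed

text \<open>The integral over \<open>Q\<close> is cut down to a part \<open>B\<close> where the
  integrand is known to be large: a far corner cube for \<open>M w\<close>, the unit cube for
  \<open>M (f / w)\<close>.\<close>

lemma average_ge:
  assumes "B \<subseteq> Q" "B \<in> sets lebesgue" "\<And>y. y \<in> B \<Longrightarrow> c \<le> g y"
  shows "c * emeasure lebesgue B / emeasure lebesgue Q \<le> average Q g"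
proof -
  have "c * emeasure lebesgue B = (\<integral>\<^sup>+ y. c * indicator B y \<partial>lebesgue)"
    by (rule nn_integral_cmult_indicator[symmetric]) (rule assms)
  also have "\<dots> \<le> (\<integral>\<^sup>+ y \<in> Q. g y \<partial>lebesgue)"
    by (rule nn_integral_mono) (use assms in \<open>auto simp: indicator_def\<close>)
  finally show ?thesis
    unfolding average_def by (rule divide_right_mono_ennreal)
qed

lemma average_le_maximal:
  "Q \<in> cubes \<Longrightarrow> x \<in> Q \<Longrightarrow> average Q (\<lambda>y. ennreal \<bar>f y\<bar>) \<le> maximal f x"
  unfolding maximal_def by (rule SUP_upper) simp

section \<open>Measurability of the maximal function\<close>

lemma less_divide_ennreal_iff:
  fixes s A :: ennreal
  assumes "0 < v"
  shows "s < A / ennreal v \<longleftrightarrow> s * ennreal v < A"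
  using assms
  by (cases s; cases A)
    (auto simp: divide_ennreal ennreal_less_iff pos_less_divide_eq ennreal_top_divide
      ennreal_mult_less_top ennreal_mult_eq_top_iff less_top simp flip: ennreal_mult)

text \<open>A cube with large average can be enlarged slightly, so it may be replaced by an open
  neighbourhood of itself.\<close>

lemma open_maximal_greater:
  fixes f :: "real ^ 'n \<Rightarrow> real"
  shows "open {x. s < maximal f x}"
proof (subst open_subopen, intro ballI)
  fix x assume "x \<in> {x. s < maximal f x}"
  then obtain Q where Q: "Q \<in> cubes" "x \<in> Q" "s < average Q (\<lambda>y. ennreal \<bar>f y\<bar>)"
    unfolding maximal_def by (auto simp: less_SUP_iff)
  from Q(1) obtain a l where al: "Q = cbox a (a + vec l)" "0 < l"
      "emeasure lebesgue Q = ennreal (l ^ CARD('n))"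
    by (rule cubesE)
  define A where "A = (\<integral>\<^sup>+ y \<in> Q. ennreal \<bar>f y\<bar> \<partial>lebesgue)"
  have sA: "s < A / ennreal (l ^ CARD('n))"
    using Q(3) al by (simp add: average_def A_def)
  then obtain r where r: "s = ennreal r" "0 \<le> r"
    by (cases s) auto
  have "s * ennreal (l ^ CARD('n)) < A"
    using sA al(2) by (simp add: less_divide_ennreal_iff)
  then have "ennreal (r * l ^ CARD('n)) < A"
    using r al(2) by (simp add: ennreal_mult)
  \<comment> \<open>Growing the cube by \<open>d\<close> on every side gives side
    \<open>l + 2 * d\<close>. The volume is continuous in \<open>d\<close>, so the strict inequality
    at \<open>d = 0\<close> survives for small positive \<open>d\<close>.\<close>
  moreover have "((\<lambda>d. ennreal (r * (l + 2 * d) ^ CARD('n))) \<longlongrightarrow> ennreal (r * (l + 2 * 0) ^ CARD('n))) (at_right 0)"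
    by (intro tendsto_intros)
  ultimately have "\<forall>\<^sub>F d in at_right 0. ennreal (r * (l + 2 * d) ^ CARD('n)) < A"
    by (intro order_tendstoD(2)) auto
  then have "\<forall>\<^sub>F d in at_right 0. 0 < d \<and> ennreal (r * (l + 2 * d) ^ CARD('n)) < A"
    by (intro eventually_conj eventually_at_right_less)
  then obtain d where d: "0 < d" "ennreal (r * (l + 2 * d) ^ CARD('n)) < A"
    using eventually_happens[of _ "at_right (0::real)"] by auto
  define Q' where "Q' = cbox (a - vec d) ((a - vec d) + vec (l + 2 * d))"
  have Q': "Q' \<in> cubes"
    unfolding Q'_def cubes_def using al(2) d(1) by fastforce
  have QQ': "Q \<subseteq> Q'"
  proof
    fix z assume "z \<in> Q"
    then have z: "a $ i \<le> z $ i" "z $ i \<le> a $ i + l" for i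
      by (simp_all add: al mem_box_cart)
    have "(a - vec d) $ i \<le> z $ i \<and> z $ i \<le> (a - vec d + vec (l + 2 * d)) $ i" for i
      using z[of i] d(1) by simp
    then show "z \<in> Q'"
      by (simp only: Q'_def mem_box_cart) simp
  qed
  have "s * ennreal ((l + 2 * d) ^ CARD('n)) < A"
    using d r al(2) by (simp add: ennreal_mult)
  then have "s < A / ennreal ((l + 2 * d) ^ CARD('n))"
    using al(2) d(1) by (simp add: less_divide_ennreal_iff)
  also have "\<dots> \<le> average Q' (\<lambda>y. ennreal \<bar>f y\<bar>)"
  proof -
    have "A \<le> (\<integral>\<^sup>+ y \<in> Q'. ennreal \<bar>f y\<bar> \<partial>lebesgue)"
      unfolding A_def by (rule nn_integral_mono) (use QQ' in \<open>auto simp: indicator_def\<close>)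
    moreover have "emeasure lebesgue Q' = ennreal ((l + 2 * d) ^ CARD('n))"
      unfolding Q'_def by (rule emeasure_cube) (use al(2) d(1) in simp)
    ultimately show ?thesis
      unfolding average_def by (simp add: divide_right_mono_ennreal)
  qed
  finally have avg: "s < average Q' (\<lambda>y. ennreal \<bar>f y\<bar>)" .
  have "interior Q' \<subseteq> {x. s < maximal f x}"
    using average_le_maximal[OF Q'] avg interior_subset by (fastforce intro: less_le_trans)
  moreover have "x \<in> interior Q'"
  proof -
    have x: "a $ i \<le> x $ i" "x $ i \<le> a $ i + l" for i
      using Q(2) by (simp_all add: al mem_box_cart)
    have "(a - vec d) $ i < x $ i \<and> x $ i < (a - vec d + vec (l + 2 * d)) $ i" for i
      using x[of i] d(1) by simp
    then show ?thesis
      by (simp only: Q'_def interior_cbox mem_box_cart) simp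
  qed
  ultimately show "\<exists>T. open T \<and> x \<in> T \<and> T \<subseteq> {x. s < maximal f x}"
    by blast
qed

lemma borel_measurable_maximal: "maximal f \<in> borel_measurable borel"
  by (rule borel_measurableI_greater) (simp add: open_maximal_greater)

section \<open>The logarithmic weight\<close>

definition log_size :: "real ^ 'n \<Rightarrow> real" where
  "log_size x = 1 + ln (1 + norm x)"

text \<open>For \<open>q = p - 1\<close> the dual weight, the power \<open>- 1 / (p - 1)\<close>, is
  exactly \<open>1 / log_size\<close>, which reduces the \<open>A_p\<close> condition to an estimate
  free of \<open>p\<close>.\<close>

definition log_weight :: "real \<Rightarrow> real ^ 'n \<Rightarrow> real" where
  "log_weight q x = log_size x powr q"

lemma log_size_ge_1: "1 \<le> log_size x"
  by (simp add: log_size_def)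

lemma log_weight_pos: "0 < log_weight q x"
  using log_size_ge_1[of x] by (simp add: log_weight_def)

lemma continuous_on_log_size: "continuous_on S log_size"
  unfolding log_size_def
  by (intro continuous_intros ballI) (smt (verit) norm_ge_zero)

lemma continuous_on_log_weight: "continuous_on S (log_weight q)"
  unfolding log_weight_def
  by (intro continuous_intros continuous_on_log_size ballI) (smt (verit) log_size_ge_1)

lemma log_weight_ge:
  assumes "0 \<le> q" "0 \<le> y" "exp y \<le> norm x"
  shows "(1 + y) powr q \<le> log_weight q x"
proof -
  have "y = ln (exp y)"
    by simp
  also have "\<dots> \<le> ln (1 + norm x)"
    using assms(3) by (intro ln_mono) (auto intro: add_pos_nonneg)
  finally show ?thesis
    using assms unfolding log_weight_def log_size_def by (intro powr_mono2) auto
qed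

lemma weight_log_weight: "weight (log_weight q)"
  unfolding weight_def locally_integrable_def
proof (intro conjI allI impI)
  show "0 \<le> log_weight q x" for x :: "real ^ 'n"
    using log_weight_pos[of q x] by simp
  fix K :: "(real ^ 'n) set" assume "compact K"
  then have "set_integrable lborel K (log_weight q)"
    unfolding set_integrable_def
    using borel_integrable_compact[OF _ continuous_on_log_weight] by simp
  then show "set_integrable lebesgue K (log_weight q)"
    unfolding set_integrable_def by (simp add: integrable_completion)
qed

section \<open>Norms and logarithms on cubes\<close>

lemma le_norm_of_mem_cube:
  fixes x :: "real ^ 'n"
  assumes "x \<in> cbox (vec r) (vec s)"
  shows "r \<le> norm x"
proof -
  \<comment> \<open>Index types are inhabited, which is \<open>n \<ge> 1\<close>; any single
    coordinate will do.\<close>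
  obtain i :: 'n where True by simp
  have "r \<le> x $ i"
    using assms by (simp add: mem_box_cart)
  also have "\<dots> \<le> norm x"
    using component_le_norm_cart[of x i] by simp
  finally show ?thesis .
qed

text \<open>Comparison with the l1 norm; the sharper factor \<open>sqrt n\<close> would only change
  constants.\<close>

lemma norm_diff_cube_le:
  fixes x :: "real ^ 'n" and l :: real
  assumes "x \<in> cbox a (a + vec l)"
  shows "norm (x - a) \<le> real CARD('n) * l"
proof -
  have "norm (x - a) \<le> (\<Sum>i\<in>UNIV. \<bar>(x - a) $ i\<bar>)"
    by (rule norm_le_l1_cart)
  also have "\<dots> \<le> (\<Sum>i\<in>(UNIV :: 'n set). l)"
  proof (rule sum_mono)
    fix i
    have "a $ i \<le> x $ i" "x $ i \<le> a $ i + l"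
      using assms by (auto simp: mem_box_cart)
    then show "\<bar>(x - a) $ i\<bar> \<le> l"
      by simp
  qed
  finally show ?thesis
    by simp
qed

text \<open>Here \<open>y\<close> stands for the logarithm of a large radius: this is the
  unboundedness of the weight, used to contradict a finite bound \<open>m\<close>.\<close>

lemma ex_powr_ge:
  fixes B q :: real
  assumes "0 < q"
  shows "\<exists>y\<ge>0. B \<le> (1 + y) powr q"
proof (intro exI conjI)
  let ?y = "\<bar>B\<bar> powr (1 / q)"
  show "0 \<le> ?y" by simp
  have "\<bar>B\<bar> = ?y powr q"
    using assms by (simp add: powr_powr)
  also have "\<dots> \<le> (1 + ?y) powr q"
    using assms by (intro powr_mono2) auto
  finally show "B \<le> (1 + ?y) powr q"
    by simp
qed

text \<open>A factor 2 shifts the logarithm by \<open>ln 2 \<le> 3 / 4\<close>. This leaves at least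
  \<open>1 / 4\<close> of the leading 1, whence the constant 4.\<close>

lemma log_size_comparable:
  assumes "1 \<le> U" "U / 2 \<le> 1 + norm x" "1 + norm x \<le> 2 * U"
  shows "(1 + ln U) / 4 \<le> log_size x" "log_size x \<le> 2 * (1 + ln U)"
proof -
  have ln2: "ln (2::real) \<le> 3 / 4" "0 < ln (2::real)"
    using ln2_le_25_over_36 by auto
  have "ln (U / 2) \<le> ln (1 + norm x)" "ln (1 + norm x) \<le> ln (2 * U)"
    using assms by (auto intro!: ln_mono add_pos_nonneg)
  then have "ln U - ln 2 \<le> ln (1 + norm x)" "ln (1 + norm x) \<le> ln 2 + ln U"
    using assms by (auto simp: ln_div ln_mult)
  moreover have "0 \<le> ln U"
    using assms by simp
  ultimately show "(1 + ln U) / 4 \<le> log_size x" "log_size x \<le> 2 * (1 + ln U)"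
    using ln2 unfolding log_size_def by (simp, linarith?)+
qed

text \<open>Off the cube \<open>C\<close> of half side \<open>sqrt R\<close> the integrand is at
  most \<open>2 / L\<close>; on \<open>C\<close> it is at most 1, and the volume of \<open>C\<close>
  relative to that of the cube is at most a constant times \<open>1 / sqrt R\<close>, hence times
  \<open>2 / L\<close>. The position \<open>a\<close> is arbitrary.\<close>

lemma average_inverse_log_size_le:
  fixes a :: "real ^ 'n" and l R :: real
  assumes "0 < l" and R: "R = 3 * real CARD('n) * l" "1 \<le> R"
  shows "average (cbox a (a + vec l)) (\<lambda>x. ennreal (1 / log_size x))
    \<le> ennreal ((2 * (6 * real CARD('n)) ^ CARD('n) + 2) / (1 + ln R))"
proof -
  let ?n = "CARD('n)" and ?Q = "cbox a (a + vec l)"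
  define s where "s = sqrt R"
  define L where "L = 1 + ln R"
  define C where "C = cbox (vec (- s) :: real ^ 'n) (vec s)"
  have s: "1 \<le> s" "s * s = R"
    using R by (auto simp: s_def)
  have L: "1 \<le> L" "L \<le> 2 * s"
  proof -
    show "1 \<le> L" using R by (simp add: L_def)
    have "ln R = 2 * ln s"
      using s ln_mult[of s s] by simp
    \<comment> \<open>From \<open>ln s \<le> s - 1\<close>,
      \<open>1 + 2 * ln s \<le> 2 * s - 1\<close>.\<close>
    then show "L \<le> 2 * s"
      using ln_le_minus_one[of s] s by (simp add: L_def)
  qed
  have mC: "emeasure lebesgue C = ennreal ((2 * s) ^ ?n)"
    using emeasure_cube_between[of "- s" s, where 'n = 'n] s unfolding C_def
    by (simp only: mult_2 diff_minus_eq_add)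
  have mQ: "emeasure lebesgue ?Q = ennreal (l ^ ?n)"
    by (rule emeasure_cube) (use assms in simp)
  have ln_R: "ln R = 2 * ln s"
    using s ln_mult[of s s] by simp
  have pt: "1 / log_size x \<le> 2 / L" if "x \<notin> C" for x
  proof -
    from that obtain i where "\<not> (- s \<le> x $ i \<and> x $ i \<le> s)"
      by (auto simp: C_def mem_box_cart)
    then have "s < \<bar>x $ i\<bar>"
      by linarith
    then have "s < norm x"
      using component_le_norm_cart[of x i] by simp
    then have "ln s \<le> ln (1 + norm x)"
      using s by (intro ln_mono) linarith+
    moreover have "(1 + 2 * u) / 2 \<le> 1 + v" if "u \<le> v" for u v :: real
      using that by simp
    ultimately have "L / 2 \<le> log_size x"
      unfolding L_def log_size_def ln_R by blast
    then have "1 / log_size x \<le> 1 / (L / 2)"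
      using L(1) by (intro frac_le) auto
    then show ?thesis
      by simp
  qed
  have "(\<integral>\<^sup>+ x \<in> ?Q. ennreal (1 / log_size x) \<partial>lebesgue)
    \<le> (\<integral>\<^sup>+ x. indicator C x + ennreal (2 / L) * indicator ?Q x \<partial>lebesgue)"
  proof (rule nn_integral_mono)
    fix x :: "real ^ 'n"
    have "ennreal (1 / log_size x) \<le> 1"
      using log_size_ge_1[of x] by simp
    then show "ennreal (1 / log_size x) * indicator ?Q x
      \<le> indicator C x + ennreal (2 / L) * indicator ?Q x"
      using pt[of x] by (cases "x \<in> C") (auto simp: indicator_def intro: ennreal_leI add_increasing2)
  qed
  also have "\<dots> = ennreal ((2 * s) ^ ?n) + ennreal (2 / L) * ennreal (l ^ ?n)"
  proof -
    have sets: "C \<in> sets lebesgue" "?Q \<in> sets lebesgue"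
      by (simp_all add: C_def)
    then have "(\<lambda>x. indicator C x :: ennreal) \<in> borel_measurable lebesgue"
      "(\<lambda>x. ennreal (2 / L) * indicator ?Q x) \<in> borel_measurable lebesgue"
      by measurable
    then show ?thesis
      by (simp only: nn_integral_add nn_integral_cmult_indicator[OF sets(2)]
          nn_integral_indicator[OF sets(1)] mC mQ)
  qed
  also have "\<dots> = ennreal ((2 * s) ^ ?n + 2 / L * l ^ ?n)"
  proof -
    have "0 \<le> (2 * s) ^ ?n" "0 \<le> 2 / L" "0 \<le> l ^ ?n"
      using s(1) L(1) assms(1) by simp_all
    then show ?thesis
      by (simp only: ennreal_plus ennreal_mult mult_nonneg_nonneg)
  qed
  finally have "average ?Q (\<lambda>x. ennreal (1 / log_size x))
      \<le> ennreal ((2 * s) ^ ?n + 2 / L * l ^ ?n) / ennreal (l ^ ?n)"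
    unfolding average_def mQ by (rule divide_right_mono_ennreal)
  also have "\<dots> = ennreal (((2 * s) ^ ?n + 2 / L * l ^ ?n) / l ^ ?n)"
    using s(1) L(1) assms(1) by (intro divide_ennreal) auto
  also have "\<dots> \<le> ennreal ((2 * (6 * real ?n) ^ ?n + 2) / L)"
  proof (rule ennreal_leI)
    define k where "k = (6 * real ?n) ^ ?n"
    have "0 \<le> k" by (simp add: k_def)
    \<comment> \<open>Both sides are \<open>2 * R\<close>; this is the origin of the factor
      \<open>6 * n\<close>.\<close>
    have "(2 * s) * s = (6 * real ?n) * l"
      using s(2) R(1) by (simp only: mult.assoc)
    then have "2 * s / l = (6 * real ?n) * (1 / s)"
      using s(1) assms(1) by (simp add: frac_eq_eq)
    then have "(2 * s) ^ ?n / l ^ ?n = k * (1 / s) ^ ?n"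
      by (simp only: k_def power_divide[symmetric] power_mult_distrib[symmetric])
    \<comment> \<open>One factor \<open>1 / s\<close> out of \<open>n\<close> already beats the
      logarithm.\<close>
    moreover have "(1 / s) ^ ?n \<le> (1 / s) ^ 1"
      using s(1) by (intro power_decreasing) auto
    moreover have "1 / s \<le> 2 / L"
      using s(1) L by (simp add: divide_le_eq pos_le_divide_eq mult.commute)
    ultimately have "(2 * s) ^ ?n / l ^ ?n \<le> k * (2 / L)"
      using \<open>0 \<le> k\<close> by (simp only: power_one_right) (intro mult_left_mono, linarith+)
    moreover have "((2 * s) ^ ?n + 2 / L * l ^ ?n) / l ^ ?n = (2 * s) ^ ?n / l ^ ?n + 2 / L"
      using assms(1) by (simp add: add_divide_distrib)
    moreover have "(2 * k + 2) / L = k * (2 / L) + 2 / L"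
      by (simp add: add_divide_distrib)
    ultimately have "((2 * s) ^ ?n + 2 / L * l ^ ?n) / l ^ ?n \<le> (2 * k + 2) / L"
      by linarith
    then show "((2 * s) ^ ?n + 2 / L * l ^ ?n) / l ^ ?n \<le> (2 * (6 * real ?n) ^ ?n + 2) / L"
      unfolding k_def .
  qed
  finally show ?thesis
    unfolding L_def .
qed

text \<open>The \<open>A_p\<close> balance without \<open>p\<close>: one scale \<open>L\<close> per
  cube bounds \<open>log_size\<close> from above and its reciprocal on average. Cubes small compared
  with \<open>1 + norm a\<close> are nearly constant for \<open>log_size\<close>; for the others
  \<open>L\<close> is read off from the side length.\<close>

lemma log_size_balanced:
  "\<exists>C::real>0. \<forall>Q :: (real ^ 'n) set \<in> cubes. \<exists>L>0. (\<forall>x\<in>Q. log_size x \<le> C * L) \<and>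
      average Q (\<lambda>x. ennreal (1 / log_size x)) \<le> ennreal (C / L)"
proof -
  let ?n = "CARD('n)"
  \<comment> \<open>Large enough for both cases: 4 for the small cubes,
    \<open>2 * (6 * n) ^ n + 2\<close> for the large ones.\<close>
  define C :: real where "C = 2 * (6 * real ?n) ^ ?n + 4"
  have C: "4 \<le> C" "2 * (6 * real ?n) ^ ?n + 2 \<le> C"
    by (auto simp: C_def)
  show ?thesis
  proof (rule exI[of _ C], intro conjI ballI)
    show "0 < C" using C by simp
    fix Q :: "(real ^ 'n) set" assume Q: "Q \<in> cubes"
    then obtain a l where al: "Q = cbox a (a + vec l)" "0 < l"
      by (rule cubesE)
    define U where "U = 1 + norm a"
    have near: "\<bar>(1 + norm x) - U\<bar> \<le> ?n * l" if "x \<in> Q" for x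
      using norm_diff_cube_le[of x a l] that al norm_triangle_ineq3[of x a] by (simp add: U_def)
    have U: "1 \<le> U" by (simp add: U_def)
    show "\<exists>L>0. (\<forall>x\<in>Q. log_size x \<le> C * L) \<and>
      average Q (\<lambda>x. ennreal (1 / log_size x)) \<le> ennreal (C / L)"
    proof (cases "2 * ?n * l \<le> U")
      case True
      let ?L = "1 + ln U"
      have L: "0 < ?L" using U by (simp add: add_pos_nonneg)
      \<comment> \<open>On \<open>Q\<close>, \<open>1 + norm x\<close> differs from \<open>U\<close>
        by at most \<open>n * l \<le> U / 2\<close>.\<close>
      have b: "?L / 4 \<le> log_size x" "log_size x \<le> 2 * ?L" if "x \<in> Q" for x
        using log_size_comparable[OF U, of x] near[OF that] True by (auto simp: abs_le_iff)
      have "log_size x \<le> C * ?L" if "x \<in> Q" for x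
        using b(2)[OF that] C L mult_right_mono[of 2 C ?L] by linarith
      moreover have "average Q (\<lambda>x. ennreal (1 / log_size x)) \<le> ennreal (C / ?L)"
      proof (rule average_le[OF Q])
        fix x assume "x \<in> Q"
        have "1 / log_size x \<le> 4 / ?L"
          using b(1)[OF \<open>x \<in> Q\<close>] L log_size_ge_1[of x] by (simp add: field_simps)
        also have "\<dots> \<le> C / ?L"
          using C L by (simp add: divide_right_mono)
        finally show "ennreal (1 / log_size x) \<le> ennreal (C / ?L)"
          by (rule ennreal_leI)
      qed
      ultimately show ?thesis using L by blast
    next
      case False
      \<comment> \<open>Since \<open>U < 2 * n * l\<close>, adding the deviation
        \<open>n * l\<close> gives \<open>1 + norm x \<le> 3 * n * l\<close> on
        \<open>Q\<close>.\<close>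
      define R where "R = 3 * real ?n * l"
      have R: "1 \<le> R" using False U al(2) by (simp add: R_def)
      let ?L = "1 + ln R"
      have L: "0 < ?L" using R by (simp add: add_pos_nonneg)
      have "log_size x \<le> C * ?L" if "x \<in> Q" for x
      proof -
        have "1 + norm x \<le> R"
          using near[OF that] False by (simp add: R_def abs_le_iff)
        then have "log_size x \<le> ?L"
          unfolding log_size_def by (simp add: ln_mono add_pos_nonneg)
        also have "\<dots> \<le> C * ?L"
          using C L mult_right_mono[of 1 C ?L] by simp
        finally show ?thesis .
      qed
      moreover have "average Q (\<lambda>x. ennreal (1 / log_size x)) \<le> ennreal (C / ?L)"
        unfolding al(1)
        by (rule order_trans[OF average_inverse_log_size_le[OF al(2) R_def R]])
          (use C L in \<open>intro ennreal_leI divide_right_mono\<close>, auto)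
      ultimately show ?thesis using L by blast
    qed
  qed
qed

section \<open>Membership in \<open>A_p\<close>\<close>

lemma epowr_ennreal: "0 < x \<Longrightarrow> epowr (ennreal x) a = ennreal (x powr a)"
  by (auto simp: epowr_def)

lemma epowr_le_ennreal:
  assumes "x \<le> ennreal y" "0 < y" "0 < a"
  shows "epowr x a \<le> ennreal (y powr a)"
proof -
  have fin: "x \<noteq> top" using assms by (auto simp: top_unique)
  have "enn2real x \<le> y"
    using assms by (simp add: enn2real_leI)
  then show ?thesis
    using assms fin by (auto simp: epowr_def intro!: ennreal_leI powr_mono2)
qed

text \<open>The average of the weight is at most \<open>(C * L) powr (p - 1)\<close> and the dual
  factor at most \<open>(C / L) powr (p - 1)\<close>; the scale \<open>L\<close> cancels in the
  product.\<close>

lemma log_weight_in_A_p: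
  assumes "1 < p"
  shows "(log_weight (p - 1) :: real ^ 'n \<Rightarrow> real) \<in> A_p p"
proof -
  let ?w = "log_weight (p - 1) :: real ^ 'n \<Rightarrow> real"
  obtain C :: real where C: "0 < C"
    "\<forall>Q :: (real ^ 'n) set \<in> cubes. \<exists>L>0. (\<forall>x\<in>Q. log_size x \<le> C * L) \<and>
      average Q (\<lambda>x. ennreal (1 / log_size x)) \<le> ennreal (C / L)"
    using log_size_balanced by blast
  have inv: "epowr (ennreal (?w y)) (- 1 / (p - 1)) = ennreal (1 / log_size y)" for y
  proof -
    have "?w y powr (- 1 / (p - 1)) = log_size y powr (- 1)"
      using assms by (simp add: log_weight_def powr_powr)
    also have "\<dots> = 1 / log_size y"
      using log_size_ge_1[of y] by (simp add: powr_minus divide_simps)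
    finally show ?thesis
      by (simp add: epowr_ennreal log_weight_pos)
  qed
  have "(SUP Q \<in> cubes. average Q (\<lambda>y. ennreal (?w y)) *
      epowr (average Q (\<lambda>y. epowr (ennreal (?w y)) (- 1 / (p - 1)))) (p - 1))
      \<le> ennreal ((C * C) powr (p - 1))"
  proof (rule SUP_least)
    fix Q :: "(real ^ 'n) set" assume Q: "Q \<in> cubes"
    from C(2) Q obtain L where L: "0 < L" "\<forall>x\<in>Q. log_size x \<le> C * L"
      "average Q (\<lambda>x. ennreal (1 / log_size x)) \<le> ennreal (C / L)"
      by blast
    have "average Q (\<lambda>y. ennreal (?w y)) \<le> ennreal ((C * L) powr (p - 1))"
    proof (rule average_le[OF Q])
      fix y assume "y \<in> Q"
      then show "ennreal (?w y) \<le> ennreal ((C * L) powr (p - 1))"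
        using L assms log_size_ge_1[of y] unfolding log_weight_def
        by (intro ennreal_leI powr_mono2) auto
    qed
    moreover have "epowr (average Q (\<lambda>y. epowr (ennreal (?w y)) (- 1 / (p - 1)))) (p - 1)
      \<le> ennreal ((C / L) powr (p - 1))"
      unfolding inv using L C(1) assms by (intro epowr_le_ennreal) auto
    ultimately have "average Q (\<lambda>y. ennreal (?w y)) *
      epowr (average Q (\<lambda>y. epowr (ennreal (?w y)) (- 1 / (p - 1)))) (p - 1)
      \<le> ennreal ((C * L) powr (p - 1)) * ennreal ((C / L) powr (p - 1))"
      by (rule mult_mono) auto
    also have "\<dots> = ennreal (((C * L) * (C / L)) powr (p - 1))"
      using L C(1) by (subst powr_mult) (auto simp: ennreal_mult)
    also have "(C * L) * (C / L) = C * C"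
      using L by simp
    finally show "average Q (\<lambda>y. ennreal (?w y)) *
      epowr (average Q (\<lambda>y. epowr (ennreal (?w y)) (- 1 / (p - 1)))) (p - 1)
      \<le> ennreal ((C * C) powr (p - 1))" .
  qed
  also have "\<dots> < \<infinity>"
    by simp
  finally show ?thesis
    unfolding A_p_def by (simp add: weight_log_weight)
qed

section \<open>Failure of the \<open>A_1\<close> condition\<close>

lemma maximal_log_weight:
  fixes x :: "real ^ 'n"
  assumes "0 < q"
  shows "maximal (log_weight q) x = \<infinity>"
proof (rule ccontr)
  let ?n = "CARD('n)" and ?w = "log_weight q :: real ^ 'n \<Rightarrow> real"
  assume "maximal ?w x \<noteq> \<infinity>"
  then obtain m where m: "maximal ?w x = ennreal m" "0 \<le> m"
    by (cases "maximal ?w x") auto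
  \<comment> \<open>\<open>4 ^ n\<close> is the volume ratio of \<open>?Q\<close> to
    \<open>?B\<close> below, \<open>m + 1\<close> makes the final contradiction strict, and the last
    factor is at least 1.\<close>
  obtain y where y: "0 \<le> y" "4 ^ ?n * (m + 1) * (1 + norm x) ^ ?n \<le> (1 + y) powr q"
    using ex_powr_ge[OF assms] by blast
  \<comment> \<open>The product dominates both \<open>exp y\<close>, so that the weight is large on
    \<open>?B\<close>, and \<open>norm x\<close>, so that \<open>x\<close> lies in
    \<open>?Q\<close>.\<close>
  define R where "R = exp y * (1 + norm x)"
  have ey: "1 \<le> exp y" using y by simp
  have R: "0 < R" "exp y \<le> R" "norm x \<le> R"
  proof -
    show "0 < R" by (simp add: R_def add_pos_nonneg)
    show "exp y \<le> R" by (simp add: R_def)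
    show "norm x \<le> R"
      using mult_right_mono[OF ey, of "1 + norm x"] by (simp add: R_def)
  qed
  \<comment> \<open>The corner \<open>?B\<close> fills the proportion \<open>4 ^ (- n)\<close> of
    \<open>?Q\<close> and stays at distance at least \<open>R\<close> from the origin.\<close>
  let ?Q = "cbox (vec (- 2 * R) :: real ^ 'n) (vec (2 * R))"
  let ?B = "cbox (vec R :: real ^ 'n) (vec (2 * R))"
  have Q: "?Q \<in> cubes" by (rule cube_between) (use R in simp)
  have "x \<in> ?Q"
    unfolding mem_box_cart
  proof
    fix i
    show "vec (- 2 * R) $ i \<le> x $ i \<and> x $ i \<le> vec (2 * R) $ i"
      using component_le_norm_cart[of x i] R by (simp add: abs_le_iff)
  qed
  have "ennreal ((1 + y) powr q) * emeasure lebesgue ?B / emeasure lebesgue ?Q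
      \<le> average ?Q (\<lambda>y. ennreal \<bar>?w y\<bar>)"
  proof (rule average_ge)
    show "?B \<subseteq> ?Q"
      using R by (auto simp: mem_box_cart) (smt (verit))
    show "?B \<in> sets lebesgue" by simp
    fix z assume "z \<in> ?B"
    then have "exp y \<le> norm z"
      using le_norm_of_mem_cube R(2) by (meson order_trans)
    then have "(1 + y) powr q \<le> ?w z"
      using y assms by (intro log_weight_ge) auto
    then show "ennreal ((1 + y) powr q) \<le> ennreal \<bar>?w z\<bar>"
      by (intro ennreal_leI) simp
  qed
  also have "\<dots> \<le> ennreal m"
    using average_le_maximal[OF Q \<open>x \<in> ?Q\<close>, of ?w] m by simp
  also have "ennreal ((1 + y) powr q) * emeasure lebesgue ?B / emeasure lebesgue ?Q
      = ennreal ((1 + y) powr q * R ^ ?n / (4 * R) ^ ?n)"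
    using R emeasure_cube_between[of R "2 * R", where 'n = 'n]
      emeasure_cube_between[of "- 2 * R" "2 * R", where 'n = 'n]
    by (simp add: ennreal_mult divide_ennreal flip: ennreal_mult)
  finally have "(1 + y) powr q * R ^ ?n / (4 * R) ^ ?n \<le> m"
    using m by simp
  then have "(1 + y) powr q \<le> 4 ^ ?n * m"
    using R by (simp add: power_mult_distrib field_simps)
  moreover have "4 ^ ?n * (m + 1) * 1 \<le> 4 ^ ?n * (m + 1) * (1 + norm x) ^ ?n"
    using m by (intro mult_left_mono) auto
  ultimately show False
    using y(2) by (simp add: algebra_simps) (smt (verit) zero_less_power)
qed

text \<open>The left side of the \<open>A_1\<close> inequality is infinite and the right side finite
  at every point, while Lebesgue measure is nonzero.\<close>

lemma log_weight_notin_A_1: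
  assumes "0 < q"
  shows "(log_weight q :: real ^ 'n \<Rightarrow> real) \<notin> A_1"
proof
  assume "(log_weight q :: real ^ 'n \<Rightarrow> real) \<in> A_1"
  then obtain C where "AE x :: real ^ 'n in lebesgue.
      maximal (log_weight q) x \<le> ennreal C * ennreal (log_weight q x)"
    by (auto simp: A_1_def)
  then have "AE x :: real ^ 'n in lebesgue. False"
    by (simp add: maximal_log_weight[OF assms] ennreal_mult_eq_top_iff top_unique)
  then show False
    by (simp add: ae_filter_eq_bot_iff flip: trivial_limit_def)
qed

section \<open>Failure of the weak type bound\<close>

lemma weak_L1_norm_ge:
  assumes "0 < t" "B \<subseteq> {x. ennreal t < g x}" "g \<in> borel_measurable lebesgue"
  shows "ennreal t * emeasure lebesgue B \<le> weak_L1_norm g"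
proof -
  \<comment> \<open>\<open>emeasure\<close> is 0 on nonmeasurable sets, so monotonicity needs the
    superlevel set to be measurable.\<close>
  have "{x \<in> space lebesgue. ennreal t < g x} \<in> sets lebesgue"
    using assms(3) by measurable
  then have "emeasure lebesgue B \<le> emeasure lebesgue {x. ennreal t < g x}"
    using assms(2) by (intro emeasure_mono) auto
  then have "ennreal t * emeasure lebesgue B \<le> ennreal t * emeasure lebesgue {x. ennreal t < g x}"
    by (rule mult_left_mono) simp
  also have "\<dots> \<le> weak_L1_norm g"
    unfolding weak_L1_norm_def by (rule SUP_upper) (use assms in simp)
  finally show ?thesis .
qed

lemma borel_measurable_weighted_maximal:
  assumes "w \<in> borel_measurable borel"
  shows "weighted_maximal w f \<in> borel_measurable lebesgue"
proof -
  have "weighted_maximal w f \<in> borel_measurable borel"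
    unfolding weighted_maximal_def
    using assms borel_measurable_maximal[of "\<lambda>y. f y / w y"] by measurable
  then show ?thesis
    by (intro measurable_completion) simp
qed

text \<open>At a level of order \<open>W * R ^ (- n)\<close>, with
  \<open>W = (1 + ln R) powr q\<close>, the superlevel set contains a cube of volume
  \<open>R ^ n\<close>. The weak norm is thus at least a constant times \<open>W\<close>, which is
  unbounded in \<open>R\<close>.\<close>

lemma weak_L1_norm_weighted_maximal_log_weight:
  assumes "0 < q"
  shows "weak_L1_norm (weighted_maximal (log_weight q)
    (indicator (cbox (vec 0) (vec 1)) :: real ^ 'n \<Rightarrow> real)) = \<infinity>"
proof (rule ccontr)
  let ?n = "CARD('n)" and ?w = "log_weight q :: real ^ 'n \<Rightarrow> real"
  define Q0 where "Q0 = cbox (vec 0 :: real ^ 'n) (vec 1)"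
  let ?f = "indicator Q0 :: real ^ 'n \<Rightarrow> real"
  let ?T = "weighted_maximal ?w ?f"
  assume "weak_L1_norm (weighted_maximal ?w (indicator (cbox (vec 0) (vec 1)))) \<noteq> \<infinity>"
  then obtain m where m: "weak_L1_norm ?T = ennreal m" "0 \<le> m"
    unfolding Q0_def by (cases "weak_L1_norm ?T") (auto simp: Q0_def)
  have "compact (?w ` Q0)"
    unfolding Q0_def by (intro compact_continuous_image continuous_on_log_weight compact_cbox)
  then obtain K where K: "\<forall>z \<in> ?w ` Q0. \<bar>z\<bar> \<le> K" and "0 < K"
    using compact_imp_bounded bounded_pos by (metis real_norm_def)
  \<comment> \<open>\<open>2 ^ n\<close> comes from the volume of \<open>?Q\<close>, the next 2 from
    halving the level, \<open>K\<close> from the weight on the unit cube; \<open>m + 1\<close> gives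
    strictness.\<close>
  obtain y where y: "0 \<le> y" "2 ^ ?n * 2 * K * (m + 1) \<le> (1 + y) powr q"
    using ex_powr_ge[OF assms] by blast
  define R where "R = exp y"
  have R: "1 \<le> R" using y by (simp add: R_def)
  define W where "W = (1 + y) powr q"
  have W: "0 < W" using y by (simp add: W_def)
  let ?Q = "cbox (vec 0 :: real ^ 'n) (vec (2 * R))"
  let ?B = "cbox (vec R :: real ^ 'n) (vec (2 * R))"
  \<comment> \<open>Lower bound for the average of \<open>f / w\<close> over \<open>?Q\<close>: at
    least \<open>1 / K\<close> on the unit cube, divided by the volume of \<open>?Q\<close>.\<close>
  define c where "c = 1 / K / (2 * R) ^ ?n"
  have c: "0 < c" using R \<open>0 < K\<close> by (simp add: c_def)
  have Q: "?Q \<in> cubes" by (rule cube_between) (use R in simp)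
  have big: "ennreal (W * c) \<le> ?T x" if "x \<in> ?B" for x
  proof -
    have x: "x \<in> ?Q"
      using that R by (auto simp: mem_box_cart) (smt (verit))
    have "ennreal c = ennreal (1 / K) * emeasure lebesgue Q0 / emeasure lebesgue ?Q"
      using R \<open>0 < K\<close> emeasure_cube_between[of 0 1, where 'n = 'n]
        emeasure_cube_between[of 0 "2 * R", where 'n = 'n]
      by (simp add: Q0_def c_def divide_ennreal)
    also have "\<dots> \<le> average ?Q (\<lambda>y. ennreal \<bar>?f y / ?w y\<bar>)"
    proof (rule average_ge)
      show "Q0 \<subseteq> ?Q"
        using R unfolding Q0_def by (auto simp: mem_box_cart) (smt (verit))
      show "Q0 \<in> sets lebesgue" by (simp add: Q0_def)
      fix z assume "z \<in> Q0"
      then have "?w z \<le> K" using K by force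
      then have "1 / K \<le> 1 / ?w z"
        using log_weight_pos[of q z] by (intro divide_left_mono) (auto simp: \<open>0 < K\<close>)
      then show "ennreal (1 / K) \<le> ennreal \<bar>?f z / ?w z\<bar>"
        using \<open>z \<in> Q0\<close> log_weight_pos[of q z] by (intro ennreal_leI) simp
    qed
    also have "\<dots> \<le> maximal (\<lambda>y. ?f y / ?w y) x"
      by (rule average_le_maximal[OF Q x])
    finally have 1: "ennreal c \<le> maximal (\<lambda>y. ?f y / ?w y) x" .
    have "W \<le> ?w x"
      unfolding W_def using le_norm_of_mem_cube[OF that] assms y by (intro log_weight_ge) (auto simp: R_def)
    then have "ennreal W * ennreal c \<le> ?T x"
      unfolding weighted_maximal_def using 1 by (intro mult_mono ennreal_leI) auto
    then show ?thesis using W c by (simp add: ennreal_mult)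
  qed
  \<comment> \<open>The level is halved because \<open>weak_L1_norm\<close> uses strict superlevel
    sets, while \<open>big\<close> is a weak inequality.\<close>
  have "ennreal (W * c / 2) * emeasure lebesgue ?B \<le> weak_L1_norm ?T"
  proof (rule weak_L1_norm_ge)
    show "0 < W * c / 2" using W c by simp
    have "ennreal (W * c / 2) < ennreal (W * c)"
      using W c by (intro ennreal_lessI) auto
    then show "?B \<subseteq> {x. ennreal (W * c / 2) < ?T x}"
      using big by (auto intro: less_le_trans)
    show "?T \<in> borel_measurable lebesgue"
      by (intro borel_measurable_weighted_maximal borel_measurable_continuous_onI
          continuous_on_log_weight)
  qed
  then have "ennreal (W * c / 2 * R ^ ?n) \<le> ennreal m"
    using m R W c emeasure_cube_between[of R "2 * R", where 'n = 'n] by (subst ennreal_mult) auto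
  then have "W * c / 2 * R ^ ?n \<le> m"
    using m by (subst (asm) ennreal_le_iff)
  \<comment> \<open>The powers of \<open>R\<close> cancel, as
    \<open>c * R ^ n = 1 / (K * 2 ^ n)\<close>.\<close>
  then have "W \<le> 2 ^ ?n * 2 * K * m"
    using R \<open>0 < K\<close> by (simp add: c_def power_mult_distrib field_simps)
  moreover have "0 < 2 ^ ?n * 2 * K"
    using \<open>0 < K\<close> by simp
  ultimately show False
    using y(2) unfolding W_def[symmetric] by (simp add: algebra_simps)
qed

theorem mainTheorem3:
  fixes p :: real
  assumes "1 < p"
  shows "\<exists>w :: real ^ 'n \<Rightarrow> real. w \<in> A_p p - A_1 \<and>
    L1_weak_L1_opnorm (weighted_maximal w) = \<infinity>"
proof (intro exI conjI)
  let ?w = "log_weight (p - 1) :: real ^ 'n \<Rightarrow> real"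
  define Q0 where "Q0 = cbox (vec 0 :: real ^ 'n) (vec 1)"
  let ?f = "indicator Q0 :: real ^ 'n \<Rightarrow> real"
  show "?w \<in> A_p p - A_1"
    using assms log_weight_in_A_p log_weight_notin_A_1[of "p - 1"] by auto
  have mQ0: "emeasure lebesgue Q0 = 1" "Q0 \<in> sets lebesgue"
    using emeasure_cube_between[of 0 1, where 'n = 'n] by (auto simp: Q0_def)
  have int: "integrable lebesgue ?f"
    using mQ0 by (simp add: integrable_indicator_iff)
  have L1: "L1_norm ?f = 1"
    using mQ0 by (simp add: L1_norm_def ennreal_indicator)
  have "\<not> (AE x in lebesgue. ?f x = 0)"
  proof
    assume "AE x in lebesgue. ?f x = 0"
    then have "L1_norm ?f = (\<integral>\<^sup>+ x. 0 \<partial>(lebesgue :: (real ^ 'n) measure))"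
      unfolding L1_norm_def by (intro nn_integral_cong_AE) auto
    then show False using L1 by simp
  qed
  with int have "weak_L1_norm (weighted_maximal ?w ?f) / L1_norm ?f
      \<le> L1_weak_L1_opnorm (weighted_maximal ?w)"
    unfolding L1_weak_L1_opnorm_def by (intro SUP_upper) simp
  \<comment> \<open>The test function has L1 norm 1, so its quotient is already infinite.\<close>
  then show "L1_weak_L1_opnorm (weighted_maximal ?w) = \<infinity>"
    using weak_L1_norm_weighted_maximal_log_weight[of "p - 1", where 'n = 'n] assms L1
    by (simp add: Q0_def top_unique ennreal_top_divide)
qed

end
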